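(* Let $\mathcal{V}_1,\mathcal{V}_2,\mathcal{W}_1,\mathcal{W}_2$ be unital operator spaces and let $\phi_i:\mathcal{V}_i\to\mathcal{W}_i$ be unital completely contractive maps for $i=1,2$. Then the map $\phi_1\otimes_h\phi_2:\mathcal{V}_1\otimes_h\mathcal{V}_2\to\mathcal{W}_1\otimes_h\mathcal{W}_2$, defined by $[\phi_1\otimes_h\phi_2](a\otimes b)=\phi_1(a)\otimes\phi_2(b)$ on elementary tensors and extended linearly, is a unital complete contraction. Moreover, if each map $\phi_i$ is completely isometric, then $\phi_1\otimes_h\phi_2$ is a unital complete isometry.
   Context: An operator space $\mathcal{V}$ with a distinguished element $e$, $\|e\|=1$, is a unital operator space with unit $e$ if there are a Hilbert space $\mathcal{H}$ and a complete isometry $\varphi:\mathcal{V}\to\mathbb{B}(\mathcal{H})$ with $\varphi(e)=I_{\mathcal{H}}$. For operator spaces $\mathcal{X},\mathcal{Y}$, $x=(x_{ij})\in M_{n,k}(\mathcal{X})$ and $y=(y_{ij})\in M_{k,m}(\mathcal{Y})$, put $x\odot y=(\sum_{l}x_{il}\otimes y_{lj})_{i,j}\in M_{n,m}(\mathcal{X}\otimes\mathcal{Y})$. The Haagerup tensor product $\mathcal{X}\otimes_h\mathcal{Y}$ is the algebraic tensor product $\mathcal{X}\otimes\mathcal{Y}$ with the matrix norms $\|z\|_h=\inf\{\|x\|\|y\| : z=x\odot y\}$. If $\mathcal{V},\mathcal{W}$ are unital operator spaces with units $e,f$, then $\mathcal{V}\otimes_h\mathcal{W}$ is a unital operator space with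 unit $e\otimes f$. *)

theory Defs
  imports
    Complex_Main
    "HOL-Library.Poly_Mapping"
    "Jordan_Normal_Form.Matrix"
begin

section \<open>Complex vector spaces and Hilbert spaces\<close>

class complex_vector = ab_group_add +
  fixes scaleC :: "complex \<Rightarrow> 'a \<Rightarrow> 'a" (infixr "*\<^sub>C" 75)
  assumes scaleC_add_right: "c *\<^sub>C (x + y) = c *\<^sub>C x + c *\<^sub>C y"
    and scaleC_add_left: "(c + d) *\<^sub>C x = c *\<^sub>C x + d *\<^sub>C x"
    and scaleC_scaleC: "c *\<^sub>C d *\<^sub>C x = (c * d) *\<^sub>C x"
    and scaleC_one: "1 *\<^sub>C x = x"

interpretation complex_vector:
  vector_space "scaleC :: complex \<Rightarrow> 'a \<Rightarrow> 'a::complex_vector"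
  by unfold_locales
    (simp_all add: scaleC_add_right scaleC_add_left scaleC_scaleC scaleC_one)

abbreviation clinear :: "('a::complex_vector \<Rightarrow> 'b::complex_vector) \<Rightarrow> bool" where
  "clinear \<equiv> Vector_Spaces.linear scaleC scaleC"

lemma clinearI:
  fixes f :: "'a::complex_vector \<Rightarrow> 'b::complex_vector"
  assumes "\<And>x y. f (x + y) = f x + f y" "\<And>c x. f (c *\<^sub>C x) = c *\<^sub>C f x"
  shows "clinear f"
  by (intro Vector_Spaces.linear.intro module_hom.intro module_hom_axioms.intro)
    (simp_all add: assms complex_vector.vector_space_axioms complex_vector.module_axioms)

lemma clinear_add: "clinear f \<Longrightarrow> f (x + y) = f x + f y"
  by (meson Vector_Spaces.linear.axioms(3) module_hom.add)

lemma clinear_scaleC: "clinear f \<Longrightarrow> f (c *\<^sub>C x) = c *\<^sub>C f x"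
  by (meson Vector_Spaces.linear.axioms(3) module_hom.scale)

text \<open>The inner product is linear in its first argument. The last axiom says that it is positive
  definite and that it induces the given norm.\<close>

class chilbert_space = complex_vector + banach +
  fixes cinner :: "'a \<Rightarrow> 'a \<Rightarrow> complex"
  assumes scaleR_scaleC: "r *\<^sub>R x = complex_of_real r *\<^sub>C x"
    and cinner_commute: "cinner x y = cnj (cinner y x)"
    and cinner_add_left: "cinner (x + y) z = cinner x z + cinner y z"
    and cinner_scaleC_left: "cinner (c *\<^sub>C x) y = c * cinner x y"
    and cinner_self: "cinner x x = complex_of_real ((norm x)\<^sup>2)"

text \<open>The algebra of bounded complex-linear operators on a Hilbert space.\<close>

typedef (overloaded) 'h bop =
  "{T :: 'h::chilbert_space \<Rightarrow> 'h. clinear T \<and> bounded_linear T}"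
  morphisms apply_bop Abs_bop
  by (rule exI[of _ "\<lambda>_. 0"]) (auto intro!: clinearI bounded_linear_zero)

setup_lifting type_definition_bop

lemma clinear_bounded_linear_scaleC:
  fixes T :: "'h::chilbert_space \<Rightarrow> 'h"
  assumes T: "clinear T" and B: "bounded_linear T"
  shows "clinear (\<lambda>x. c *\<^sub>C T x) \<and> bounded_linear (\<lambda>x. c *\<^sub>C T x)"
proof
  show cl: "clinear (\<lambda>x. c *\<^sub>C T x)"
    by (rule clinearI)
      (simp_all add: clinear_add[OF T] clinear_scaleC[OF T] scaleC_add_right scaleC_scaleC
        mult.commute)
  have nrm: "norm (c *\<^sub>C y) = cmod c * norm y" for y :: 'h
  proof -
    have "complex_of_real ((norm (c *\<^sub>C y))\<^sup>2) = (c * cnj c) * complex_of_real ((norm y)\<^sup>2)"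
    proof -
      have "cinner (c *\<^sub>C y) (c *\<^sub>C y) = c * cnj (cinner (c *\<^sub>C y) y)"
        unfolding cinner_scaleC_left[of c y "c *\<^sub>C y"] by (rule arg_cong[OF cinner_commute])
      also have "\<dots> = c * cnj c * cnj (cinner y y)"
        unfolding cinner_scaleC_left by simp
      finally show ?thesis
        unfolding cinner_self by simp
    qed
    also have "\<dots> = complex_of_real ((cmod c * norm y)\<^sup>2)"
      unfolding complex_norm_square[symmetric] of_real_mult[symmetric] of_real_power[symmetric]
        power_mult_distrib ..
    finally have "(norm (c *\<^sub>C y))\<^sup>2 = (cmod c * norm y)\<^sup>2"
      by (rule of_real_eq_iff[THEN iffD1])
    then show ?thesis
      by (rule power2_eq_imp_eq) simp_all
  qed
  obtain K where K: "\<And>x. norm (T x) \<le> norm x * K"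
    using bounded_linear.bounded[OF B] by blast
  show "bounded_linear (\<lambda>x. c *\<^sub>C T x)"
  proof (rule bounded_linear_intro)
    show "c *\<^sub>C T (x + y) = c *\<^sub>C T x + c *\<^sub>C T y" for x y
      using clinear_add[OF cl] .
    show "c *\<^sub>C T (r *\<^sub>R x) = r *\<^sub>R (c *\<^sub>C T x)" for r x
      unfolding scaleR_scaleC using clinear_scaleC[OF cl] .
    show "norm (c *\<^sub>C T x) \<le> norm x * (cmod c * K)" for x
      using mult_left_mono[OF K[of x] norm_ge_zero[of c]] by (simp add: nrm algebra_simps)
  qed
qed

instantiation bop :: (chilbert_space) complex_vector
begin

lift_definition zero_bop :: "'a bop" is "\<lambda>_. 0"
  by (auto intro!: clinearI bounded_linear_zero)

lift_definition plus_bop :: "'a bop \<Rightarrow> 'a bop \<Rightarrow> 'a bop" is "\<lambda>S T x. S x + T x"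
  by (auto intro!: clinearI bounded_linear_add
      simp: clinear_add clinear_scaleC scaleC_add_right algebra_simps)

lift_definition scaleC_bop :: "complex \<Rightarrow> 'a bop \<Rightarrow> 'a bop" is "\<lambda>c T x. c *\<^sub>C T x"
  using clinear_bounded_linear_scaleC by blast

definition uminus_bop :: "'a bop \<Rightarrow> 'a bop" where "uminus_bop T = (-1) *\<^sub>C T"

definition minus_bop :: "'a bop \<Rightarrow> 'a bop \<Rightarrow> 'a bop" where "minus_bop S T = S + - T"

instance
proof
  fix a b c :: "'a bop" and r s :: complex
  show "a + b + c = a + (b + c)" by transfer (auto simp: add.assoc)
  show "a + b = b + a" by transfer (auto simp: add.commute)
  show "0 + a = a" by transfer auto
  have "x + (-1) *\<^sub>C x = 0" for x :: 'a by simp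
  then show "- a + a = 0" unfolding uminus_bop_def by transfer (auto simp: add.commute)
  show "a - b = a + - b" by (rule minus_bop_def)
  show "r *\<^sub>C (a + b) = r *\<^sub>C a + r *\<^sub>C b" by transfer (auto simp: scaleC_add_right)
  show "(r + s) *\<^sub>C a = r *\<^sub>C a + s *\<^sub>C a" by transfer (auto simp: scaleC_add_left)
  show "r *\<^sub>C s *\<^sub>C a = (r * s) *\<^sub>C a" by transfer (auto simp: scaleC_scaleC)
  show "1 *\<^sub>C a = a" by transfer (auto simp: scaleC_one)
qed

end

lift_definition id_bop :: "'h::chilbert_space bop" is "\<lambda>x. x"
  by (auto intro!: clinearI bounded_linear_ident)


section \<open>Matrix norms and operator spaces\<close>

text \<open>The operator norm of an \<open>n \<times> m\<close> matrix of operators on a Hilbert space \<open>H\<close>, regarded as an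
  operator from the Hilbert sum \<open>H\<^sup>m\<close> to \<open>H\<^sup>n\<close>. For bounded entries the set is bounded.\<close>

definition opmat_norm ::
    "nat \<Rightarrow> nat \<Rightarrow> (nat \<Rightarrow> nat \<Rightarrow> 'h::real_normed_vector \<Rightarrow> 'h) \<Rightarrow> real" where
  "opmat_norm n m T =
     Sup {sqrt (\<Sum>i<n. (norm (\<Sum>j<m. T i j (\<xi> j)))\<^sup>2) | \<xi>. (\<Sum>j<m. (norm (\<xi> j))\<^sup>2) \<le> 1}"

definition bop_norm :: "'h::chilbert_space bop mat \<Rightarrow> real" where
  "bop_norm x = opmat_norm (dim_row x) (dim_col x) (\<lambda>i j. apply_bop (x $$ (i, j)))"

definition cmat_norm :: "complex mat \<Rightarrow> real" where
  "cmat_norm \<alpha> = opmat_norm (dim_row \<alpha>) (dim_col \<alpha>) (\<lambda>i j. (*) (\<alpha> $$ (i, j)))"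

text \<open>The product \<open>\<alpha> x \<beta>\<close> of scalar matrices \<open>\<alpha>\<close>, \<open>\<beta>\<close> and a vector-valued matrix \<open>x\<close>.\<close>

definition bimod_mult ::
    "complex mat \<Rightarrow> 'v::complex_vector mat \<Rightarrow> complex mat \<Rightarrow> 'v mat" where
  "bimod_mult \<alpha> x \<beta> = mat (dim_row \<alpha>) (dim_col \<beta>)
     (\<lambda>(i, j). \<Sum>k<dim_row x. \<Sum>l<dim_col x. (\<alpha> $$ (i, k) * \<beta> $$ (l, j)) *\<^sub>C x $$ (k, l))"

definition direct_sum_mat :: "'v::zero mat \<Rightarrow> 'v mat \<Rightarrow> 'v mat" where
  "direct_sum_mat x y =
     four_block_mat x (0\<^sub>m (dim_row x) (dim_col y)) (0\<^sub>m (dim_row y) (dim_col x)) y"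

text \<open>Ruan's axioms for a single function giving the norms on all spaces \<open>M\<^sub>n\<^sub>,\<^sub>m(V)\<close>. They are imposed
  for rectangular matrices; the norm of a rectangular matrix is thereby the norm of the square
  matrix obtained by adding zero rows or columns. Completeness is not required.\<close>

locale operator_space =
  fixes mnorm :: "'v::complex_vector mat \<Rightarrow> real"
  assumes mnorm_nonneg: "0 \<le> mnorm x"
    and mnorm_eq_0_iff: "mnorm x = 0 \<longleftrightarrow> x = 0\<^sub>m (dim_row x) (dim_col x)"
    and mnorm_triangle: "x \<in> carrier_mat n m \<Longrightarrow> y \<in> carrier_mat n m \<Longrightarrow>
          mnorm (x + y) \<le> mnorm x + mnorm y"
    and mnorm_scaleC: "mnorm (map_mat (scaleC c) x) = cmod c * mnorm x"
    and mnorm_bimod: "\<alpha> \<in> carrier_mat n p \<Longrightarrow> x \<in> carrier_mat p q \<Longrightarrow> \<beta> \<in> carrier_mat q m \<Longrightarrow>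
          mnorm (bimod_mult \<alpha> x \<beta>) \<le> cmat_norm \<alpha> * mnorm x * cmat_norm \<beta>"
    and mnorm_direct_sum: "mnorm (direct_sum_mat x y) = max (mnorm x) (mnorm y)"

definition completely_contractive ::
    "('v::complex_vector mat \<Rightarrow> real) \<Rightarrow> ('w::complex_vector mat \<Rightarrow> real) \<Rightarrow> ('v \<Rightarrow> 'w) \<Rightarrow> bool" where
  "completely_contractive NV NW \<phi> \<longleftrightarrow>
     clinear \<phi> \<and> (\<forall>n. \<forall>x\<in>carrier_mat n n. NW (map_mat \<phi> x) \<le> NV x)"

definition completely_isometric ::
    "('v::complex_vector mat \<Rightarrow> real) \<Rightarrow> ('w::complex_vector mat \<Rightarrow> real) \<Rightarrow> ('v \<Rightarrow> 'w) \<Rightarrow> bool" where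
  "completely_isometric NV NW \<phi> \<longleftrightarrow>
     clinear \<phi> \<and> (\<forall>n. \<forall>x\<in>carrier_mat n n. NW (map_mat \<phi> x) = NV x)"

text \<open>A definition cannot quantify existentially over types, so the type \<open>'h\<close> of the representing
  Hilbert space is a parameter. As a hypothesis of a theorem with \<open>'h\<close> occurring nowhere else,
  \<open>unital_operator_space TYPE('h) N e\<close> expresses that there is some such Hilbert space.\<close>

definition unital_operator_space ::
    "'h::chilbert_space itself \<Rightarrow> ('v::complex_vector mat \<Rightarrow> real) \<Rightarrow> 'v \<Rightarrow> bool" where
  "unital_operator_space H N e \<longleftrightarrow>
     operator_space N \<and> N (mat 1 1 (\<lambda>_. e)) = 1 \<and>
     (\<exists>\<phi> :: 'v \<Rightarrow> 'h bop. completely_isometric N bop_norm \<phi> \<and> \<phi> e = id_bop)"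


section \<open>The algebraic tensor product\<close>

instantiation complex :: complex_vector
begin

definition scaleC_complex :: "complex \<Rightarrow> complex \<Rightarrow> complex" where
  "scaleC_complex = (*)"

instance
  by standard (simp_all add: scaleC_complex_def algebra_simps)

end

instantiation poly_mapping :: (type, complex_vector) complex_vector
begin

lift_definition scaleC_poly_mapping :: "complex \<Rightarrow> ('a \<Rightarrow>\<^sub>0 'b) \<Rightarrow> ('a \<Rightarrow>\<^sub>0 'b)"
  is "\<lambda>c f k. c *\<^sub>C f k"
proof -
  fix c and f :: "'a \<Rightarrow> 'b" assume "finite {k. f k \<noteq> 0}"
  then show "finite {k. c *\<^sub>C f k \<noteq> 0}"
    by (rule rev_finite_subset) auto
qed

instance
  by (standard; rule poly_mapping_eqI)
    (simp_all add: lookup_add scaleC_poly_mapping.rep_eq scaleC_add_right scaleC_add_left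
      scaleC_scaleC scaleC_one)

end

text \<open>\<open>V \<otimes> W\<close> is the free complex vector space on \<open>V \<times> W\<close> modulo the subspace spanned by the
  bilinearity relations.\<close>

abbreviation free_gen :: "'a \<Rightarrow> 'b \<Rightarrow> ('a \<times> 'b) \<Rightarrow>\<^sub>0 complex" where
  "free_gen a b \<equiv> Poly_Mapping.single (a, b) 1"

inductive_set bilinear_relators ::
    "(('a::complex_vector \<times> 'b::complex_vector) \<Rightarrow>\<^sub>0 complex) set" where
  "free_gen (a + a') b - (free_gen a b + free_gen a' b) \<in> bilinear_relators"
| "free_gen a (b + b') - (free_gen a b + free_gen a b') \<in> bilinear_relators"
| "free_gen (c *\<^sub>C a) b - c *\<^sub>C free_gen a b \<in> bilinear_relators"
| "free_gen a (c *\<^sub>C b) - c *\<^sub>C free_gen a b \<in> bilinear_relators"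

quotient_type (overloaded) ('a, 'b) tensor =
  "('a::complex_vector \<times> 'b::complex_vector) \<Rightarrow>\<^sub>0 complex" /
  "\<lambda>p q. p - q \<in> complex_vector.span bilinear_relators"
proof (rule equivpI)
  let ?N = "complex_vector.span bilinear_relators :: (('a \<times> 'b) \<Rightarrow>\<^sub>0 complex) set"
  show "reflp (\<lambda>p q. p - q \<in> ?N)"
    by (simp add: reflp_def complex_vector.span_zero)
  show "symp (\<lambda>p q. p - q \<in> ?N)"
  proof (rule sympI)
    fix p q :: "('a \<times> 'b) \<Rightarrow>\<^sub>0 complex" assume "p - q \<in> ?N"
    from complex_vector.span_neg[OF this] show "q - p \<in> ?N" by simp
  qed
  show "transp (\<lambda>p q. p - q \<in> ?N)"
  proof (rule transpI)
    fix p q r :: "('a \<times> 'b) \<Rightarrow>\<^sub>0 complex" assume "p - q \<in> ?N" "q - r \<in> ?N"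
    from complex_vector.span_add[OF this] show "p - r \<in> ?N" by simp
  qed
qed

instantiation tensor :: (complex_vector, complex_vector) complex_vector
begin

lift_definition zero_tensor :: "('a, 'b) tensor" is 0 .

lift_definition plus_tensor :: "('a, 'b) tensor \<Rightarrow> ('a, 'b) tensor \<Rightarrow> ('a, 'b) tensor" is "(+)"
  by (metis add_diff_add complex_vector.span_add)

lift_definition uminus_tensor :: "('a, 'b) tensor \<Rightarrow> ('a, 'b) tensor" is uminus
  by (metis complex_vector.span_neg minus_diff_minus)

lift_definition minus_tensor :: "('a, 'b) tensor \<Rightarrow> ('a, 'b) tensor \<Rightarrow> ('a, 'b) tensor" is "(-)"
proof -
  fix p q r s :: "('a \<times> 'b) \<Rightarrow>\<^sub>0 complex"
  assume "p - q \<in> complex_vector.span bilinear_relators"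
    and "r - s \<in> complex_vector.span bilinear_relators"
  then have "(p - q) - (r - s) \<in> complex_vector.span bilinear_relators"
    by (rule complex_vector.span_diff)
  then show "p - r - (q - s) \<in> complex_vector.span bilinear_relators"
    by (simp add: algebra_simps)
qed

lift_definition scaleC_tensor :: "complex \<Rightarrow> ('a, 'b) tensor \<Rightarrow> ('a, 'b) tensor" is scaleC
  by (metis complex_vector.span_scale complex_vector.scale_right_diff_distrib)

instance
proof
  have eq: "p - q \<in> complex_vector.span bilinear_relators" if "p = q"
    for p q :: "('a \<times> 'b) \<Rightarrow>\<^sub>0 complex"
    using that by (simp add: complex_vector.span_zero)
  fix a b c :: "('a, 'b) tensor" and r s :: complex
  show "a + b + c = a + (b + c)" by transfer (rule eq, simp add: add.assoc)
  show "a + b = b + a" by transfer (rule eq, simp add: add.commute)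
  show "0 + a = a" by transfer (rule eq, simp)
  show "- a + a = 0" by transfer (rule eq, simp)
  show "a - b = a + - b" by transfer (rule eq, simp)
  show "r *\<^sub>C (a + b) = r *\<^sub>C a + r *\<^sub>C b" by transfer (rule eq, simp add: scaleC_add_right)
  show "(r + s) *\<^sub>C a = r *\<^sub>C a + s *\<^sub>C a" by transfer (rule eq, simp add: scaleC_add_left)
  show "r *\<^sub>C s *\<^sub>C a = (r * s) *\<^sub>C a" by transfer (rule eq, simp add: scaleC_scaleC)
  show "1 *\<^sub>C a = a" by transfer (rule eq, simp add: scaleC_one)
qed

end

lift_definition tensor_elem ::
    "'a::complex_vector \<Rightarrow> 'b::complex_vector \<Rightarrow> ('a, 'b) tensor" (infixr "\<otimes>\<^sub>t" 76)
  is free_gen .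

lemma tensor_elem_add_left: "(a + a') \<otimes>\<^sub>t b = a \<otimes>\<^sub>t b + a' \<otimes>\<^sub>t b"
  by transfer (intro complex_vector.span_base bilinear_relators.intros)

lemma tensor_elem_add_right: "a \<otimes>\<^sub>t (b + b') = a \<otimes>\<^sub>t b + a \<otimes>\<^sub>t b'"
  by transfer (intro complex_vector.span_base bilinear_relators.intros)

lemma tensor_elem_scaleC_left: "(c *\<^sub>C a) \<otimes>\<^sub>t b = c *\<^sub>C (a \<otimes>\<^sub>t b)"
  by transfer (intro complex_vector.span_base bilinear_relators.intros)

lemma tensor_elem_scaleC_right: "a \<otimes>\<^sub>t (c *\<^sub>C b) = c *\<^sub>C (a \<otimes>\<^sub>t b)"
  by transfer (intro complex_vector.span_base bilinear_relators.intros)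

definition free_extension :: "('k \<Rightarrow> 'c::complex_vector) \<Rightarrow> ('k \<Rightarrow>\<^sub>0 complex) \<Rightarrow> 'c" where
  "free_extension F p = (\<Sum>k\<in>Poly_Mapping.keys p. Poly_Mapping.lookup p k *\<^sub>C F k)"

lemma free_extension_superset:
  assumes "finite A" "Poly_Mapping.keys p \<subseteq> A"
  shows "free_extension F p = (\<Sum>k\<in>A. Poly_Mapping.lookup p k *\<^sub>C F k)"
  unfolding free_extension_def using assms
  by (intro sum.mono_neutral_left) (auto simp: in_keys_iff)

lemma clinear_free_extension: "clinear (free_extension F)"
proof (rule clinearI)
  fix p q :: "'a \<Rightarrow>\<^sub>0 complex" and c :: complex
  let ?A = "Poly_Mapping.keys p \<union> Poly_Mapping.keys q"
  have "free_extension F r = (\<Sum>k\<in>?A. Poly_Mapping.lookup r k *\<^sub>C F k)" if "r \<in> {p, q, p + q}" for r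
    using that by (intro free_extension_superset) (auto dest!: subsetD[OF keys_add])
  then show "free_extension F (p + q) = free_extension F p + free_extension F q"
    by (simp add: lookup_add scaleC_add_left sum.distrib)
  have "free_extension F (c *\<^sub>C p)
      = (\<Sum>k\<in>Poly_Mapping.keys p. Poly_Mapping.lookup (c *\<^sub>C p) k *\<^sub>C F k)"
    by (intro free_extension_superset)
      (auto simp: in_keys_iff scaleC_poly_mapping.rep_eq)
  then show "free_extension F (c *\<^sub>C p) = c *\<^sub>C free_extension F p"
    by (simp add: free_extension_def scaleC_poly_mapping.rep_eq scaleC_complex_def scaleC_scaleC
        complex_vector.scale_sum_right)
qed

lemma free_extension_free_gen: "free_extension F (free_gen a b) = F (a, b)"
  by (simp add: free_extension_def scaleC_one)

lemma clinear_diff: "clinear f \<Longrightarrow> f (x - y) = f x - f y"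
  by (meson Vector_Spaces.linear.axioms(3) module_hom.diff)

theorem tensor_universal:
  fixes B :: "'a::complex_vector \<Rightarrow> 'b::complex_vector \<Rightarrow> 'c::complex_vector"
  assumes "\<And>a. clinear (B a)" "\<And>b. clinear (\<lambda>a. B a b)"
  shows "\<exists>!h. clinear h \<and> (\<forall>a b. h (a \<otimes>\<^sub>t b) = B a b)"
proof (rule ex_ex1I)
  let ?F = "free_extension (\<lambda>(a, b). B a b)"
  have F: "clinear ?F" by (rule clinear_free_extension)
  have rel: "?F r = 0" if "r \<in> bilinear_relators" for r
    using that
    by cases (simp_all add: clinear_diff[OF F] clinear_add[OF F] clinear_scaleC[OF F]
        free_extension_free_gen clinear_add[OF assms(1)] clinear_add[OF assms(2)]
        clinear_scaleC[OF assms(1)] clinear_scaleC[OF assms(2)])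
  have ker: "?F r = 0" if "r \<in> complex_vector.span bilinear_relators" for r
    using that
    by (induction rule: complex_vector.span_induct_alt)
      (simp_all add: clinear_add[OF F] clinear_scaleC[OF F] rel free_extension_def[of _ 0])
  have resp: "?F p = ?F q" if "p - q \<in> complex_vector.span bilinear_relators" for p q
    using ker[OF that] by (simp add: clinear_diff[OF F])
  define h where "h t = ?F (rep_tensor t)" for t
  have h: "h (abs_tensor p) = ?F p" for p
    unfolding h_def by (rule resp) (rule Quotient3_rep_abs[OF Quotient3_tensor]; simp add: complex_vector.span_zero)
  have "clinear h"
  proof (rule clinearI)
    show "h (s + t) = h s + h t" for s t
      by (induction s rule: tensor.abs_induct, induction t rule: tensor.abs_induct)
        (simp add: plus_tensor.abs_eq h clinear_add[OF F])
    show "h (c *\<^sub>C t) = c *\<^sub>C h t" for c t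
      by (induction t rule: tensor.abs_induct)
        (simp add: scaleC_tensor.abs_eq h clinear_scaleC[OF F])
  qed
  moreover have "h (a \<otimes>\<^sub>t b) = B a b" for a b
    by (simp add: tensor_elem.abs_eq h free_extension_free_gen)
  ultimately show "\<exists>h. clinear h \<and> (\<forall>a b. h (a \<otimes>\<^sub>t b) = B a b)" by blast
next
  fix h g :: "('a, 'b) tensor \<Rightarrow> 'c"
  assume h: "clinear h \<and> (\<forall>a b. h (a \<otimes>\<^sub>t b) = B a b)"
    and g: "clinear g \<and> (\<forall>a b. g (a \<otimes>\<^sub>t b) = B a b)"
  have "h (abs_tensor p) = g (abs_tensor p)" for p
  proof (induction p rule: update_induct)
    case const
    have "abs_tensor 0 = (0 :: ('a, 'b) tensor)" by (simp add: zero_tensor_def)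
    then show ?case
      using h g by (metis clinear_add add_cancel_right_right)
  next
    case (update p k v)
    obtain a b where k: "k = (a, b)" by fastforce
    have "Poly_Mapping.update k v p = v *\<^sub>C free_gen a b + p"
      by (rule poly_mapping_eqI)
        (use update(1) in \<open>auto simp: lookup_update lookup_add scaleC_poly_mapping.rep_eq k
          lookup_single when_def scaleC_complex_def in_keys_iff\<close>)
    then have "abs_tensor (Poly_Mapping.update k v p) = v *\<^sub>C (a \<otimes>\<^sub>t b) + abs_tensor p"
      by (simp add: plus_tensor.abs_eq scaleC_tensor.abs_eq tensor_elem.abs_eq)
    then show ?case
      using h g update by (simp add: clinear_add clinear_scaleC)
  qed
  then show "h = g"
    by (intro ext, rule tensor.abs_induct)
qed

definition tensor_map ::
    "('a::complex_vector \<Rightarrow> 'c::complex_vector) \<Rightarrow> ('b::complex_vector \<Rightarrow> 'd::complex_vector) \<Rightarrow>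
     ('a, 'b) tensor \<Rightarrow> ('c, 'd) tensor" where
  "tensor_map f g = (THE h. clinear h \<and> (\<forall>a b. h (a \<otimes>\<^sub>t b) = f a \<otimes>\<^sub>t g b))"

lemma
  assumes "clinear f" "clinear g"
  shows clinear_tensor_map: "clinear (tensor_map f g)"
    and tensor_map_tensor_elem: "tensor_map f g (a \<otimes>\<^sub>t b) = f a \<otimes>\<^sub>t g b"
proof -
  have "\<exists>!h. clinear h \<and> (\<forall>a b. h (a \<otimes>\<^sub>t b) = f a \<otimes>\<^sub>t g b)"
    using assms
    by (intro tensor_universal clinearI)
      (simp_all add: clinear_add clinear_scaleC tensor_elem_add_left tensor_elem_add_right
        tensor_elem_scaleC_left tensor_elem_scaleC_right)
  from theI'[OF this] show "clinear (tensor_map f g)" "tensor_map f g (a \<otimes>\<^sub>t b) = f a \<otimes>\<^sub>t g b"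
    by (auto simp: tensor_map_def)
qed


section \<open>The Haagerup tensor product\<close>

definition mat_tensor ::
    "'a::complex_vector mat \<Rightarrow> 'b::complex_vector mat \<Rightarrow> ('a, 'b) tensor mat" (infixl "\<odot>\<^sub>t" 70) where
  "x \<odot>\<^sub>t y = mat (dim_row x) (dim_col y)
     (\<lambda>(i, j). \<Sum>l<dim_col x. x $$ (i, l) \<otimes>\<^sub>t y $$ (l, j))"

definition haagerup_norm ::
    "('a::complex_vector mat \<Rightarrow> real) \<Rightarrow> ('b::complex_vector mat \<Rightarrow> real) \<Rightarrow>
     ('a, 'b) tensor mat \<Rightarrow> real" where
  "haagerup_norm NX NY z =
     Inf {NX x * NY y | x y k.
       x \<in> carrier_mat (dim_row z) k \<and> y \<in> carrier_mat k (dim_col z) \<and> z = x \<odot>\<^sub>t y}"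

end

theory Submission
  imports Defs
begin

text \<open>Applying \<open>\<phi>\<^sub>1\<close> and \<open>\<phi>\<^sub>2\<close> to the factors of \<open>z = x \<odot> y\<close> gives the contractive part. For the
  isometric part, let \<open>(\<phi>\<^sub>1 \<otimes> \<phi>\<^sub>2) z = x \<odot> y\<close> over \<open>W\<^sub>1\<close> and \<open>W\<^sub>2\<close>, and let \<open>P\<close> be the orthogonal
  projection onto the space of scalar vectors obtained by applying functionals to the rows of \<open>y\<close>.
  Then \<open>P y = y\<close>, hence \<open>x \<odot> y = x P \<odot> y\<close>, and \<open>x P\<close> has its entries in the range of \<open>\<phi>\<^sub>1\<close>, because
  slicing \<open>(\<phi>\<^sub>1 \<otimes> \<phi>\<^sub>2) z\<close> by functionals on \<open>W\<^sub>2\<close> lands there. A symmetric step moves \<open>y\<close> into the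
  range of \<open>\<phi>\<^sub>2\<close>. Neither step increases norms, and \<open>\<phi>\<^sub>1 \<otimes> \<phi>\<^sub>2\<close> is injective, so the factorization
  pulls back to one of \<open>z\<close>.\<close>

section \<open>Orthogonal projections of finite-dimensional unitary space\<close>

text \<open>An orthogonal projection of \<open>k\<close>-dimensional unitary space in coordinates.
  Encoding it as a function lets its columns be members of a set of functions.\<close>

definition hermitian_idempotent :: "nat \<Rightarrow> (nat \<Rightarrow> nat \<Rightarrow> complex) \<Rightarrow> bool" where
  "hermitian_idempotent k P \<longleftrightarrow>
     (\<forall>i<k. \<forall>j<k. P j i = cnj (P i j)) \<and> (\<forall>i<k. \<forall>j<k. (\<Sum>l<k. P i l * P l j) = P i j)"

lemma hermitian_idempotentD:
  assumes "hermitian_idempotent k P" "i < k" "j < k"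
  shows "P j i = cnj (P i j)" "(\<Sum>l<k. P i l * P l j) = P i j"
  using assms unfolding hermitian_idempotent_def by blast+

text \<open>Transposing only swaps the factors of each product, and scalars commute. The transpose
  is what acts on the right tensor factor when \<open>P\<close> comes from the left one.\<close>

lemma hermitian_idempotent_transpose:
  assumes "hermitian_idempotent k P"
  shows "hermitian_idempotent k (\<lambda>i j. P j i)"
proof -
  have "(\<Sum>l<k. P l i * P j l) = P j i" if "i < k" "j < k" for i j
    using hermitian_idempotentD(2)[OF assms that(2,1)] by (simp only: mult.commute)
  then show ?thesis
    using hermitian_idempotentD(1)[OF assms] unfolding hermitian_idempotent_def by blast
qed

text \<open>Serves as the trivial second factor when a matrix is multiplied by a projection on one
  side.\<close>

lemma hermitian_idempotent_one: "hermitian_idempotent k (\<lambda>i j. if i = j then 1 else 0)"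
proof -
  have "(\<Sum>l<k. (if i = l then 1 else 0) * (if l = j then 1 else 0 :: complex))
      = (\<Sum>l<k. if i = l then if i = j then 1 else 0 else 0)" for i j
    by (intro sum.cong) auto
  then show ?thesis
    by (simp add: hermitian_idempotent_def)
qed

text \<open>Let \<open>a\<close> be the image of \<open>\<xi>\<close>. Since \<open>P\<close> is
  Hermitian and idempotent, the inner product of \<open>a\<close> and \<open>\<xi>\<close> is the
  squared norm of \<open>a\<close>. Expanding the squared norm of \<open>\<xi> - a\<close>, which is
  nonnegative, gives the bound.\<close>

lemma hermitian_idempotent_sum_le:
  assumes P: "hermitian_idempotent k P"
  shows "(\<Sum>i<k. (cmod (\<Sum>j<k. P i j * \<xi> j))\<^sup>2) \<le> (\<Sum>j<k. (cmod (\<xi> j))\<^sup>2)"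
proof -
  define a where "a i = (\<Sum>j<k. P i j * \<xi> j)" for i
  have "(\<Sum>i<k. a i * cnj (a i)) = (\<Sum>i<k. \<Sum>j<k. cnj (\<xi> j) * (cnj (P i j) * a i))"
    by (simp add: a_def sum_distrib_left mult_ac)
  also have "\<dots> = (\<Sum>j<k. cnj (\<xi> j) * (\<Sum>i<k. P j i * a i))"
    unfolding sum_distrib_left
    by (subst sum.swap) (intro sum.cong refl, simp add: hermitian_idempotentD(1)[OF P, symmetric])
  also have "\<dots> = (\<Sum>j<k. cnj (\<xi> j) * a j)"
  proof (intro sum.cong refl arg_cong[where f = "(*) _"])
    fix j assume j: "j \<in> {..<k}"
    have "(\<Sum>i<k. P j i * a i) = (\<Sum>l<k. (\<Sum>i<k. P j i * P i l) * \<xi> l)"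
      unfolding a_def sum_distrib_left sum_distrib_right
      by (subst sum.swap) (simp add: mult.assoc)
    also have "\<dots> = a j"
      unfolding a_def using j by (intro sum.cong refl) (simp add: hermitian_idempotentD(2)[OF P])
    finally show "(\<Sum>i<k. P j i * a i) = a j" .
  qed
  finally have *: "(\<Sum>i<k. a i * cnj (a i)) = (\<Sum>j<k. cnj (\<xi> j) * a j)" .
  have sq: "(cmod z)\<^sup>2 = Re (z * cnj z)" for z
    unfolding cmod_power2 by (simp add: power2_eq_square)
  have re: "(\<Sum>j<k. Re (cnj (\<xi> j) * a j)) = (\<Sum>i<k. (cmod (a i))\<^sup>2)"
    using arg_cong[OF *, of Re] by (simp only: Re_sum sq)
  have "0 \<le> (\<Sum>j<k. (cmod (\<xi> j - a j))\<^sup>2)"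
    by (intro sum_nonneg) simp
  also have "\<dots> = (\<Sum>j<k. (cmod (\<xi> j))\<^sup>2 - 2 * Re (cnj (\<xi> j) * a j) + (cmod (a j))\<^sup>2)"
    by (intro sum.cong refl) (unfold cmod_power2, simp add: power2_eq_square algebra_simps)
  also have "\<dots> = (\<Sum>j<k. (cmod (\<xi> j))\<^sup>2) - (\<Sum>j<k. (cmod (a j))\<^sup>2)"
    unfolding sum.distrib sum_subtractf sum_distrib_left[symmetric] re by simp
  finally show ?thesis by (simp add: a_def)
qed

text \<open>The set \<open>S\<close> of values contains 0, attained at the zero vector, and is
  bounded by 1, so its supremum lies between them.\<close>

lemma cmat_norm_hermitian_idempotent:
  assumes "hermitian_idempotent k P"
  shows "0 \<le> cmat_norm (mat k k (\<lambda>(i, j). P i j))" "cmat_norm (mat k k (\<lambda>(i, j). P i j)) \<le> 1"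
proof -
  define S where "S = {sqrt (\<Sum>i<k. (cmod (\<Sum>j<k. P i j * \<xi> j))\<^sup>2) |\<xi>. (\<Sum>j<k. (cmod (\<xi> j))\<^sup>2) \<le> 1}"
  have norm: "cmat_norm (mat k k (\<lambda>(i, j). P i j)) = Sup S"
    unfolding cmat_norm_def opmat_norm_def S_def
    by (intro arg_cong[where f = Sup] Collect_cong) simp
  have 0: "0 \<in> S"
    unfolding S_def by (auto intro!: exI[of _ "\<lambda>_. 0"])
  have 1: "v \<le> 1" if "v \<in> S" for v
  proof -
    obtain \<xi> where v: "v = sqrt (\<Sum>i<k. (cmod (\<Sum>j<k. P i j * \<xi> j))\<^sup>2)"
      and \<xi>: "(\<Sum>j<k. (cmod (\<xi> j))\<^sup>2) \<le> 1"
      using \<open>v \<in> S\<close> unfolding S_def by auto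
    show ?thesis
      using order_trans[OF hermitian_idempotent_sum_le[OF assms] \<xi>] by (simp add: v)
  qed
  show "0 \<le> cmat_norm (mat k k (\<lambda>(i, j). P i j))"
    unfolding norm using 0 1 by (intro cSup_upper bdd_aboveI) auto
  show "cmat_norm (mat k k (\<lambda>(i, j). P i j)) \<le> 1"
    unfolding norm using 0 1 by (intro cSup_least) auto
qed

text \<open>The projection onto \<open>K\<close> is a projection with columns in \<open>K\<close> whose trace, a natural number at
  most \<open>k\<close>, is maximal.\<close>

lemma hermitian_idempotent_onto:
  fixes K :: "(nat \<Rightarrow> complex) set"
  assumes K0: "(\<lambda>_. 0) \<in> K"
    and Kadd: "\<And>v w. v \<in> K \<Longrightarrow> w \<in> K \<Longrightarrow> (\<lambda>i. v i + w i) \<in> K"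
    and Kscale: "\<And>c v. v \<in> K \<Longrightarrow> (\<lambda>i. c * v i) \<in> K"
  obtains P where "hermitian_idempotent k P" "\<And>j. (\<lambda>i. P i j) \<in> K"
    and "\<And>v i. v \<in> K \<Longrightarrow> i < k \<Longrightarrow> (\<Sum>j<k. P i j * v j) = v i"
proof -
  define Q where "Q r P \<longleftrightarrow> hermitian_idempotent k P \<and> (\<forall>j. (\<lambda>i. P i j) \<in> K) \<and>
    (\<Sum>i<k. P i i) = of_nat r" for r :: nat and P
  have bound: "r \<le> k" if "Q r P" for r P
  proof -
    have P: "hermitian_idempotent k P" and tr: "(\<Sum>i<k. P i i) = of_nat r"
      using that by (auto simp: Q_def)
    \<comment> \<open>The diagonal entry is the squared norm of row \<open>i\<close>, hence at least
      the square of its own modulus. A real number not below its square is at most 1.\<close>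
    have "Re (P i i) \<le> 1" if i: "i < k" for i
    proof -
      have "P i i = (\<Sum>l<k. P i l * P l i)"
        using hermitian_idempotentD(2)[OF P i i] by simp
      also have "\<dots> = (\<Sum>l<k. P i l * cnj (P i l))"
        using hermitian_idempotentD(1)[OF P i] by (intro sum.cong refl) simp
      finally have "Re (P i i) = (\<Sum>l<k. (cmod (P i l))\<^sup>2)"
        by (metis (no_types, lifting) Re_complex_of_real complex_norm_square of_real_sum sum.cong)
      moreover have "(cmod (P i i))\<^sup>2 \<le> (\<Sum>l<k. (cmod (P i l))\<^sup>2)"
        using i by (intro member_le_sum) auto
      moreover have "(Re (P i i))\<^sup>2 \<le> (cmod (P i i))\<^sup>2"
        by (simp add: cmod_power2)
      ultimately have "Re (P i i) * Re (P i i) \<le> Re (P i i)"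
        by (simp add: power2_eq_square)
      then show ?thesis
        using mult_strict_right_mono[of 1 "Re (P i i)" "Re (P i i)"] by linarith
    qed
    then have "(\<Sum>i<k. Re (P i i)) \<le> (\<Sum>i<k. 1)"
      by (intro sum_mono) auto
    moreover have "(\<Sum>i<k. Re (P i i)) = real r"
      using arg_cong[OF tr, of Re] by simp
    ultimately show ?thesis by simp
  qed
  \<comment> \<open>The zero projection has trace 0, so traces occur; \<open>bound\<close> then
    yields a largest one.\<close>
  have "\<exists>P. Q 0 P"
    by (rule exI[of _ "\<lambda>_ _. 0"]) (simp add: Q_def hermitian_idempotent_def K0)
  then obtain r where "\<exists>P. Q r P" and max: "\<And>s. \<exists>P. Q s P \<Longrightarrow> s \<le> r"
    using Nat.ex_has_greatest_nat[of "\<lambda>r. \<exists>P. Q r P" 0 k] bound by blast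
  then obtain P where "Q r P" by blast
  then have P: "hermitian_idempotent k P" and PK: "\<And>j. (\<lambda>i. P i j) \<in> K"
    and tr: "(\<Sum>i<k. P i i) = of_nat r"
    by (auto simp: Q_def)
  have Ksum: "(\<lambda>i. \<Sum>j<n. P i j * v j) \<in> K" for v and n :: nat
  proof (induction n)
    case 0
    then show ?case using K0 by simp
  next
    case (Suc n)
    then show ?case using Kadd[OF Suc Kscale[OF PK[of n], of "v n"]] by (simp add: mult.commute)
  qed
  have proj: "(\<Sum>j<k. P i j * v j) = v i" if v: "v \<in> K" and i: "i < k" for v i
  proof (rule ccontr)
    assume neq: "(\<Sum>j<k. P i j * v j) \<noteq> v i"
    \<comment> \<open>The residual of \<open>v\<close>: it lies in \<open>K\<close>, is nonzero at
      \<open>i\<close>, and is orthogonal to the range of \<open>P\<close>.\<close>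
    define w where "w i = v i + (-1) * (\<Sum>j<k. P i j * v j)" for i
    have wK: "w \<in> K"
      unfolding w_def by (intro Kadd v Kscale Ksum)
    have Pw: "(\<Sum>j<k. P i j * w j) = 0" if i: "i < k" for i
    proof -
      have "(\<Sum>j<k. P i j * (\<Sum>l<k. P j l * v l)) = (\<Sum>l<k. (\<Sum>j<k. P i j * P j l) * v l)"
        unfolding sum_distrib_left sum_distrib_right by (subst sum.swap) (simp add: mult.assoc)
      also have "\<dots> = (\<Sum>l<k. P i l * v l)"
        using i by (intro sum.cong refl) (simp add: hermitian_idempotentD(2)[OF P])
      finally show ?thesis
        by (simp add: w_def right_diff_distrib sum_subtractf)
    qed
    have wP: "(\<Sum>j<k. cnj (w j) * P j i) = 0" if i: "i < k" for i
    proof -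
      have "(\<Sum>j<k. cnj (w j) * P j i) = cnj (\<Sum>j<k. P i j * w j)"
        unfolding cnj_sum
        using i by (intro sum.cong refl) (simp add: hermitian_idempotentD(1)[OF P i] mult.commute)
      then show ?thesis using Pw[OF i] by simp
    qed
    define s where "s = (\<Sum>i<k. cnj (w i) * w i)"
    have s_real: "s = complex_of_real (\<Sum>i<k. (cmod (w i))\<^sup>2)"
      unfolding s_def of_real_sum by (intro sum.cong refl) (simp only: complex_norm_square mult.commute)
    have "(\<Sum>i<k. (cmod (w i))\<^sup>2) > 0"
      using neq i by (intro sum_pos2[of _ i]) (auto simp: w_def)
    then have s0: "s \<noteq> 0" and cs: "cnj s = s"
      by (auto simp: s_real simp del: of_real_sum)
    \<comment> \<open>\<open>P'\<close> adds the rank-one projection onto the line of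
      \<open>w\<close>. The cross terms of its square vanish by \<open>Pw\<close> and
      \<open>wP\<close>, and its trace is larger by 1, against maximality.\<close>
    define P' where "P' i j = P i j + cnj (w j) / s * w i" for i j
    have "hermitian_idempotent k P'"
      unfolding hermitian_idempotent_def
    proof (intro conjI allI impI)
      fix i j assume i: "i < k" and j: "j < k"
      show "P' j i = cnj (P' i j)"
        using hermitian_idempotentD(1)[OF P i j] by (simp add: P'_def cs)
      have "(\<Sum>l<k. P' i l * P' l j)
          = (\<Sum>l<k. P i l * P l j) + (\<Sum>l<k. P i l * w l) * (cnj (w j) / s)
            + w i / s * (\<Sum>l<k. cnj (w l) * P l j)
            + w i / s * (cnj (w j) / s) * (\<Sum>l<k. cnj (w l) * w l)"
        unfolding P'_def sum_distrib_left sum_distrib_right sum.distrib[symmetric]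
        by (intro sum.cong refl) (simp add: algebra_simps)
      also have "\<dots> = P' i j"
        using i j s0
        by (simp add: hermitian_idempotentD(2)[OF P] Pw wP P'_def flip: s_def)
      finally show "(\<Sum>l<k. P' i l * P' l j) = P' i j" .
    qed
    moreover have "(\<lambda>i. P' i j) \<in> K" for j
      unfolding P'_def by (intro Kadd PK Kscale wK)
    moreover have "(\<Sum>i<k. P' i i) = of_nat (Suc r)"
    proof -
      have "(\<Sum>i<k. cnj (w i) / s * w i) = s / s"
        unfolding sum_divide_distrib[symmetric] times_divide_eq_left s_def[symmetric] ..
      then show ?thesis
        using s0 by (simp add: P'_def sum.distrib tr)
    qed
    ultimately have "Q (Suc r) P'" by (simp add: Q_def)
    then show False using max[of "Suc r"] by auto
  qed
  show ?thesis by (rule that[OF P PK proj])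
qed


section \<open>Linear maps and algebraic tensor products\<close>

lemma clinear_compose: "clinear f \<Longrightarrow> clinear g \<Longrightarrow> clinear (\<lambda>x. g (f x))"
  by (rule clinearI) (simp_all add: clinear_add clinear_scaleC)

lemma clinear_zero: "clinear f \<Longrightarrow> f 0 = 0"
  using clinear_diff[of f 0 0] by simp

lemma clinear_sum: "clinear f \<Longrightarrow> f (\<Sum>i\<in>A. g i) = (\<Sum>i\<in>A. f (g i))"
  by (induction A rule: infinite_finite_induct) (simp_all add: clinear_zero clinear_add)

lemma clinear_left_inverse:
  fixes f :: "'a::complex_vector \<Rightarrow> 'b::complex_vector"
  assumes "clinear f" "inj f"
  obtains g where "clinear g" "\<And>x. g (f x) = x"
proof -
  interpret vector_space_pair
    "scaleC :: complex \<Rightarrow> 'a \<Rightarrow> 'a" "scaleC :: complex \<Rightarrow> 'b \<Rightarrow> 'b" ..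
  show ?thesis
    using linear_injective_left_inverse[OF assms] that by (auto simp: fun_eq_iff)
qed

text \<open>A nonzero vector extends to a basis, so some algebraic functional takes the value 1 on
  it.\<close>

lemma clinear_functional_separates:
  fixes w :: "'a::complex_vector"
  assumes "\<And>g :: 'a \<Rightarrow> complex. clinear g \<Longrightarrow> g w = 0"
  shows "w = 0"
proof (rule ccontr)
  assume "w \<noteq> 0"
  interpret vector_space_pair
    "scaleC :: complex \<Rightarrow> 'a \<Rightarrow> 'a" "scaleC :: complex \<Rightarrow> complex \<Rightarrow> complex" ..
  have "complex_vector.independent {w}"
    using \<open>w \<noteq> 0\<close> by simp
  from linear_independent_extend[OF this, of "\<lambda>_. 1"] obtain g :: "'a \<Rightarrow> complex"
    where "clinear g" "g w = 1" by auto
  with assms show False by force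
qed

section \<open>Uniqueness, injectivity and finite sums in tensor products\<close>

lemma clinear_tensor_left: "clinear (\<lambda>a. a \<otimes>\<^sub>t b)"
  by (rule clinearI) (simp_all add: tensor_elem_add_left tensor_elem_scaleC_left)

lemma clinear_tensor_right: "clinear (\<lambda>b. a \<otimes>\<^sub>t b)"
  by (rule clinearI) (simp_all add: tensor_elem_add_right tensor_elem_scaleC_right)

text \<open>The uniqueness half of the universal property, for the bilinear map
  \<open>f (a \<otimes>\<^sub>t b)\<close>.\<close>

lemma tensor_ext:
  fixes f g :: "('a::complex_vector, 'b::complex_vector) tensor \<Rightarrow> 'c::complex_vector"
  assumes f: "clinear f" and g: "clinear g" and "\<And>a b. f (a \<otimes>\<^sub>t b) = g (a \<otimes>\<^sub>t b)"
  shows "f t = g t"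
proof -
  have "\<exists>!h. clinear h \<and> (\<forall>a b. h (a \<otimes>\<^sub>t b) = f (a \<otimes>\<^sub>t b))"
    by (rule tensor_universal)
      (rule clinear_compose[OF clinear_tensor_right f], rule clinear_compose[OF clinear_tensor_left f])
  with assms have "f = g" by metis
  then show ?thesis by simp
qed

text \<open>The tensor map of two linear left inverses is a left inverse of the tensor map.\<close>

lemma tensor_map_inj:
  assumes f: "clinear f" "inj f" and g: "clinear g" "inj g"
  shows "inj (tensor_map f g)"
proof -
  obtain f' where f': "clinear f'" "\<And>x. f' (f x) = x"
    using clinear_left_inverse[OF f] by blast
  obtain g' where g': "clinear g'" "\<And>x. g' (g x) = x"
    using clinear_left_inverse[OF g] by blast
  have "tensor_map f' g' (tensor_map f g t) = t" for t
    by (rule tensor_ext[OF clinear_compose[OF clinear_tensor_map clinear_tensor_map]])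
      (auto intro!: clinearI simp: f g f' g' tensor_map_tensor_elem)
  then show ?thesis by (rule inj_on_inverseI)
qed

text \<open>Induction on the support of a representing formal combination. The coefficient of each
  new generator is absorbed into the left tensor factor.\<close>

lemma tensor_finite_sum: "\<exists>(r::nat) a b. t = (\<Sum>q<r. a q \<otimes>\<^sub>t b q)"
proof (induction t rule: tensor.abs_induct)
  case (1 p)
  show ?case
  proof (induction p rule: update_induct)
    case const
    have "abs_tensor 0 = (0 :: ('a, 'b) tensor)" by (simp add: zero_tensor_def)
    then show ?case by (intro exI[of _ "0::nat"]) simp
  next
    case (update p k v)
    obtain a b where k: "k = (a, b)" by fastforce
    obtain r :: nat and a' b' where p: "abs_tensor p = (\<Sum>q<r. a' q \<otimes>\<^sub>t b' q)"
      using update by blast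
    have "Poly_Mapping.update k v p = v *\<^sub>C free_gen a b + p"
      by (rule poly_mapping_eqI)
        (use update(1) in \<open>auto simp: lookup_update lookup_add scaleC_poly_mapping.rep_eq k
          lookup_single when_def scaleC_complex_def in_keys_iff\<close>)
    then have "abs_tensor (Poly_Mapping.update k v p) = (v *\<^sub>C a) \<otimes>\<^sub>t b + abs_tensor p"
      unfolding tensor_elem_scaleC_left
      by (simp add: plus_tensor.abs_eq scaleC_tensor.abs_eq tensor_elem.abs_eq)
    \<comment> \<open>The new summand is stored at index \<open>r\<close>; the updates leave the
      indices below \<open>r\<close> alone.\<close>
    then have "abs_tensor (Poly_Mapping.update k v p)
        = (\<Sum>q<Suc r. (a'(r := v *\<^sub>C a)) q \<otimes>\<^sub>t (b'(r := b)) q)"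
      by (simp add: p add.commute)
    then show ?case by blast
  qed
qed

section \<open>Slice maps\<close>

text \<open>This \<open>h\<close> is the right slice map: the identity tensored with
  \<open>g\<close>, followed by scalar multiplication.\<close>

lemma slice_right:
  fixes g :: "'d::complex_vector \<Rightarrow> complex"
  assumes g: "clinear g"
  obtains h :: "('c::complex_vector, 'd) tensor \<Rightarrow> 'c"
  where "clinear h" "\<And>a b. h (a \<otimes>\<^sub>t b) = g b *\<^sub>C a"
proof -
  have "\<exists>!h. clinear h \<and> (\<forall>(a::'c) b. h (a \<otimes>\<^sub>t b) = g b *\<^sub>C a)"
    by (rule tensor_universal; rule clinearI)
      (simp_all add: clinear_add[OF g] clinear_scaleC[OF g] scaleC_add_left scaleC_add_right
        scaleC_scaleC scaleC_complex_def mult.commute)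
  then show ?thesis using that by blast
qed

lemma slice_left:
  fixes g :: "'c::complex_vector \<Rightarrow> complex"
  assumes g: "clinear g"
  obtains h :: "('c, 'd::complex_vector) tensor \<Rightarrow> 'd"
  where "clinear h" "\<And>a b. h (a \<otimes>\<^sub>t b) = g a *\<^sub>C b"
proof -
  have "\<exists>!h. clinear h \<and> (\<forall>a (b::'d). h (a \<otimes>\<^sub>t b) = g a *\<^sub>C b)"
    by (rule tensor_universal; rule clinearI)
      (simp_all add: clinear_add[OF g] clinear_scaleC[OF g] scaleC_add_left scaleC_add_right
        scaleC_scaleC scaleC_complex_def mult.commute)
  then show ?thesis using that by blast
qed

text \<open>Slicing by \<open>g\<close> after \<open>tensor_map f1 f2\<close> is the same as
  \<open>f1\<close> after slicing by \<open>g\<close> composed with \<open>f2\<close>, because the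
  two agree on elementary tensors. The sum in question is the slice of the right-hand side of
  \<open>eq\<close>.\<close>

lemma slice_right_range:
  fixes g :: "'d::complex_vector \<Rightarrow> complex" and f1 :: "'a::complex_vector \<Rightarrow> 'c::complex_vector"
    and f2 :: "'b::complex_vector \<Rightarrow> 'd"
  assumes g: "clinear g" and f: "clinear f1" "clinear f2"
    and eq: "tensor_map f1 f2 t = (\<Sum>l<k. x l \<otimes>\<^sub>t y l)"
  shows "(\<Sum>l<k. g (y l) *\<^sub>C x l) \<in> range f1"
proof -
  obtain h :: "('c, 'd) tensor \<Rightarrow> 'c" where h: "clinear h" "\<And>a b. h (a \<otimes>\<^sub>t b) = g b *\<^sub>C a"
    using slice_right[OF g] by blast
  obtain h' :: "('a, 'b) tensor \<Rightarrow> 'a"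
    where h': "clinear h'" "\<And>a b. h' (a \<otimes>\<^sub>t b) = g (f2 b) *\<^sub>C a"
    using slice_right[OF clinear_compose[OF f(2) g]] by blast
  have "h (tensor_map f1 f2 t) = f1 (h' t)"
    by (rule tensor_ext[OF clinear_compose[OF clinear_tensor_map h(1)] clinear_compose[OF h'(1)]])
      (simp_all add: f tensor_map_tensor_elem h h' clinear_scaleC)
  then show ?thesis by (simp add: eq clinear_sum[OF h(1)] h(2))
qed

lemma slice_left_range:
  fixes g :: "'c::complex_vector \<Rightarrow> complex" and f1 :: "'a::complex_vector \<Rightarrow> 'c"
    and f2 :: "'b::complex_vector \<Rightarrow> 'd::complex_vector"
  assumes g: "clinear g" and f: "clinear f1" "clinear f2"
    and eq: "tensor_map f1 f2 t = (\<Sum>l<k. x l \<otimes>\<^sub>t y l)"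
  shows "(\<Sum>l<k. g (x l) *\<^sub>C y l) \<in> range f2"
proof -
  obtain h :: "('c, 'd) tensor \<Rightarrow> 'd" where h: "clinear h" "\<And>a b. h (a \<otimes>\<^sub>t b) = g a *\<^sub>C b"
    using slice_left[OF g] by blast
  obtain h' :: "('a, 'b) tensor \<Rightarrow> 'b"
    where h': "clinear h'" "\<And>a b. h' (a \<otimes>\<^sub>t b) = g (f1 a) *\<^sub>C b"
    using slice_left[OF clinear_compose[OF f(1) g]] by blast
  have "h (tensor_map f1 f2 t) = f2 (h' t)"
    by (rule tensor_ext[OF clinear_compose[OF clinear_tensor_map h(1)] clinear_compose[OF h'(1)]])
      (simp_all add: f tensor_map_tensor_elem h h' clinear_scaleC)
  then show ?thesis by (simp add: eq clinear_sum[OF h(1)] h(2))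
qed

text \<open>Here \<open>P\<close> is the projection onto the space of all \<open>(\<Sum>\<^sub>j g\<^sub>j (y\<^sub>l\<^sub>j))\<^sub>l\<close> with linear functionals
  \<open>g\<^sub>j\<close>. Since functionals separate points, it fixes \<open>y\<close>.\<close>

lemma hermitian_idempotent_of_functionals:
  fixes y :: "nat \<Rightarrow> nat \<Rightarrow> 'd::complex_vector" and k m :: nat
  obtains P :: "nat \<Rightarrow> nat \<Rightarrow> complex" and g :: "nat \<Rightarrow> nat \<Rightarrow> 'd \<Rightarrow> complex"
  where "hermitian_idempotent k P"
    and "\<And>l j. l < k \<Longrightarrow> j < m \<Longrightarrow> (\<Sum>p<k. P l p *\<^sub>C y p j) = y l j"
    and "\<And>p j. clinear (g p j)" and "\<And>l p. P l p = (\<Sum>j<m. g p j (y l j))"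
proof -
  define K where "K = {v. \<exists>g :: nat \<Rightarrow> 'd \<Rightarrow> complex.
    (\<forall>j. clinear (g j)) \<and> v = (\<lambda>l. \<Sum>j<m. g j (y l j))}"
  have lin0: "clinear (\<lambda>_ :: 'd. 0 :: complex)"
    by (rule clinearI) simp_all
  have "(\<lambda>_. 0) \<in> K"
    unfolding K_def by (auto intro!: exI[of _ "\<lambda>_ _. 0"] simp: lin0)
  moreover have "(\<lambda>i. v i + w i) \<in> K" if vK: "v \<in> K" and wK: "w \<in> K" for v w
  proof -
    obtain g h :: "nat \<Rightarrow> 'd \<Rightarrow> complex"
      where gs: "\<forall>j. clinear (g j)" and v: "v = (\<lambda>l. \<Sum>j<m. g j (y l j))"
        and hs: "\<forall>j. clinear (h j)" and w: "w = (\<lambda>l. \<Sum>j<m. h j (y l j))"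
      using vK wK unfolding K_def by blast
    note g = gs[rule_format] and h = hs[rule_format]
    have "clinear (\<lambda>x. g j x + h j x)" for j
      by (rule clinearI)
        (simp_all add: clinear_add[OF g] clinear_add[OF h] clinear_scaleC[OF g]
          clinear_scaleC[OF h] scaleC_add_right)
    moreover have "(\<lambda>i. v i + w i) = (\<lambda>l. \<Sum>j<m. g j (y l j) + h j (y l j))"
      by (simp add: v w sum.distrib)
    ultimately show ?thesis
      unfolding K_def by (intro CollectI exI[of _ "\<lambda>j x. g j x + h j x"]) blast
  qed
  moreover have "(\<lambda>i. c * v i) \<in> K" if vK: "v \<in> K" for c v
  proof -
    obtain g :: "nat \<Rightarrow> 'd \<Rightarrow> complex"
      where gs: "\<forall>j. clinear (g j)" and v: "v = (\<lambda>l. \<Sum>j<m. g j (y l j))"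
      using vK unfolding K_def by blast
    note g = gs[rule_format]
    have "clinear (\<lambda>x. c * g j x)" for j
      by (rule clinearI)
        (simp_all add: clinear_add[OF g] clinear_scaleC[OF g] scaleC_complex_def ring_distribs)
    moreover have "(\<lambda>i. c * v i) = (\<lambda>l. \<Sum>j<m. c * g j (y l j))"
      by (simp add: v sum_distrib_left)
    ultimately show ?thesis
      unfolding K_def by (intro CollectI exI[of _ "\<lambda>j x. c * g j x"]) blast
  qed
  ultimately obtain P where P: "hermitian_idempotent k P" and PK: "\<And>j. (\<lambda>i. P i j) \<in> K"
    and proj: "\<And>v i. v \<in> K \<Longrightarrow> i < k \<Longrightarrow> (\<Sum>j<k. P i j * v j) = v i"
    using hermitian_idempotent_onto[of K k] by blast
  have fixed: "(\<Sum>p<k. P l p *\<^sub>C y p j) = y l j" if l: "l < k" and j: "j < m" for l j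
  proof -
    have "(\<Sum>p<k. P l p *\<^sub>C y p j) - y l j = 0"
    proof (rule clinear_functional_separates)
      fix g :: "'d \<Rightarrow> complex" assume g: "clinear g"
      \<comment> \<open>The family with \<open>g\<close> at position \<open>j\<close> and zero
        elsewhere shows that \<open>g\<close> applied to column \<open>j\<close> of \<open>y\<close>
        is a vector in \<open>K\<close>, hence fixed by \<open>P\<close>.\<close>
      have "(\<Sum>i<m. (if i = j then g else (\<lambda>_. 0)) (y p i))
          = (\<Sum>i<m. if i = j then g (y p i) else 0)" for p
        by (intro sum.cong) auto
      then have "(\<lambda>p. g (y p j)) = (\<lambda>p. \<Sum>i<m. (if i = j then g else (\<lambda>_. 0)) (y p i))"
        using j by simp
      then have "(\<lambda>p. g (y p j)) \<in> K"
        unfolding K_def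
        by (intro CollectI exI[of _ "\<lambda>i. if i = j then g else (\<lambda>_. 0)"]) (simp add: g lin0)
      from proj[OF this l] show "g ((\<Sum>p<k. P l p *\<^sub>C y p j) - y l j) = 0"
        by (simp add: clinear_diff[OF g] clinear_sum[OF g] clinear_scaleC[OF g] scaleC_complex_def)
    qed
    then show ?thesis by simp
  qed
  \<comment> \<open>Column \<open>p\<close> of \<open>P\<close> lies in \<open>K\<close>. Choosing
    functionals \<open>g p\<close> for it expresses the entries of \<open>P\<close> through
    \<open>y\<close>, which later turns a product with \<open>P\<close> into sums of slices.\<close>
  have "\<forall>p. \<exists>g :: nat \<Rightarrow> 'd \<Rightarrow> complex.
      (\<forall>j. clinear (g j)) \<and> (\<lambda>l. P l p) = (\<lambda>l. \<Sum>j<m. g j (y l j))"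
    using PK unfolding K_def by blast
  then obtain g :: "nat \<Rightarrow> nat \<Rightarrow> 'd \<Rightarrow> complex"
    where "\<And>p j. clinear (g p j)" "\<And>p. (\<lambda>l. P l p) = (\<lambda>l. \<Sum>j<m. g p j (y l j))"
    by metis
  then show ?thesis
    using that[OF P fixed, of g] by (simp add: fun_eq_iff)
qed

text \<open>The range of a linear map is a subspace. Each slice involves a single \<open>j\<close>,
  whereas an entry of \<open>P\<close> sums over all of them.\<close>

lemma sum_functionals_in_range:
  fixes f :: "'a::complex_vector \<Rightarrow> 'c::complex_vector" and m k :: nat
  assumes f: "clinear f" and range: "\<And>j. j < m \<Longrightarrow> (\<Sum>l<k. c l j *\<^sub>C x l) \<in> range f"
  shows "(\<Sum>l<k. (\<Sum>j<m. c l j) *\<^sub>C x l) \<in> range f"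
proof -
  have "\<forall>j\<in>{..<m}. \<exists>t. (\<Sum>l<k. c l j *\<^sub>C x l) = f t"
    using range by auto
  then obtain t where t: "\<And>j. j < m \<Longrightarrow> (\<Sum>l<k. c l j *\<^sub>C x l) = f (t j)"
    by (metis lessThan_iff)
  have "(\<Sum>l<k. (\<Sum>j<m. c l j) *\<^sub>C x l) = (\<Sum>j<m. \<Sum>l<k. c l j *\<^sub>C x l)"
    unfolding complex_vector.scale_sum_left by (rule sum.swap)
  also have "\<dots> = f (\<Sum>j<m. t j)"
    by (simp add: clinear_sum[OF f] t)
  finally show ?thesis by simp
qed


section \<open>Rectangular matrices over operator spaces\<close>

lemma dim_direct_sum_mat [simp]:
  "dim_row (direct_sum_mat x y) = dim_row x + dim_row y"
  "dim_col (direct_sum_mat x y) = dim_col x + dim_col y"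
  by (simp_all add: direct_sum_mat_def)

lemma map_mat_direct_sum_zero:
  assumes "f 0 = 0"
  shows "map_mat f (direct_sum_mat x (0\<^sub>m p q)) = direct_sum_mat (map_mat f x) (0\<^sub>m p q)"
  using assms by (intro eq_matI) (auto simp: direct_sum_mat_def)

lemma (in operator_space) mnorm_direct_sum_zero: "mnorm (direct_sum_mat x (0\<^sub>m p q)) = mnorm x"
proof -
  have "mnorm (0\<^sub>m p q) = 0" by (simp add: mnorm_eq_0_iff)
  then show ?thesis using mnorm_nonneg[of x] by (simp add: mnorm_direct_sum)
qed

text \<open>Complete contractions and isometries are defined on square matrices only. Padding carries them
  over to the rectangular factors of a Haagerup factorization.\<close>

lemma direct_sum_zero_square:
  "direct_sum_mat x (0\<^sub>m (dim_col x) (dim_row x)) \<in> carrier_mat (dim_row x + dim_col x) (dim_row x + dim_col x)"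
  by (rule carrier_matI) simp_all

lemma inj_map_mat:
  assumes "inj f"
  shows "inj (map_mat f)"
proof (rule injI)
  fix x y assume eq: "map_mat f x = map_mat f y"
  then have dim: "dim_row x = dim_row y" "dim_col x = dim_col y"
    by (metis index_map_mat(2), metis index_map_mat(3))
  have "f (x $$ (i, j)) = f (y $$ (i, j))" if "i < dim_row y" "j < dim_col y" for i j
    using arg_cong[OF eq, of "\<lambda>A. A $$ (i, j)"] that by (simp add: dim)
  then show "x = y"
    using assms by (intro eq_matI) (auto simp: dim dest: injD)
qed

lemma completely_contractiveD:
  assumes "operator_space NV" "operator_space NW" "completely_contractive NV NW f"
  shows "NW (map_mat f x) \<le> NV x"
proof -
  have f: "clinear f" and le: "\<And>n x. x \<in> carrier_mat n n \<Longrightarrow> NW (map_mat f x) \<le> NV x"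
    using assms(3) by (auto simp: completely_contractive_def)
  show ?thesis
    using le[OF direct_sum_zero_square[of x]]
    by (simp add: map_mat_direct_sum_zero clinear_zero[OF f] operator_space.mnorm_direct_sum_zero[OF assms(1)]
        operator_space.mnorm_direct_sum_zero[OF assms(2)])
qed

lemma completely_isometricD:
  assumes "operator_space NV" "operator_space NW" "completely_isometric NV NW f"
  shows "NW (map_mat f x) = NV x"
proof -
  have f: "clinear f" and eq: "\<And>n x. x \<in> carrier_mat n n \<Longrightarrow> NW (map_mat f x) = NV x"
    using assms(3) by (auto simp: completely_isometric_def)
  show ?thesis
    using eq[OF direct_sum_zero_square[of x]]
    by (simp add: map_mat_direct_sum_zero clinear_zero[OF f] operator_space.mnorm_direct_sum_zero[OF assms(1)]
        operator_space.mnorm_direct_sum_zero[OF assms(2)])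
qed

text \<open>At the 1 by 1 level, \<open>x - y\<close> has the same norm as its image
  \<open>f x - f y\<close>, which is zero.\<close>

lemma completely_isometric_inj:
  assumes "operator_space NV" "operator_space NW" "completely_isometric NV NW f"
  shows "inj f"
proof (rule injI)
  fix x y assume "f x = f y"
  moreover have f: "clinear f"
    using assms(3) by (simp add: completely_isometric_def)
  ultimately have "map_mat f (mat 1 1 (\<lambda>_. x - y)) = 0\<^sub>m 1 1"
    by (intro eq_matI) (auto simp: clinear_diff)
  then have "NV (mat 1 1 (\<lambda>_. x - y)) = NW (0\<^sub>m 1 1)"
    using completely_isometricD[OF assms, of "mat 1 1 (\<lambda>_. x - y)"] by simp
  also have "\<dots> = 0"
    by (simp add: operator_space.mnorm_eq_0_iff[OF assms(2)])
  finally have "mat 1 1 (\<lambda>_. x - y) = 0\<^sub>m 1 1"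
    by (simp add: operator_space.mnorm_eq_0_iff[OF assms(1)])
  then have "mat 1 1 (\<lambda>_. x - y) $$ (0, 0) = 0\<^sub>m 1 1 $$ (0, 0)"
    by (rule arg_cong)
  then show "x = y" by simp
qed

section \<open>Multiplication by projections\<close>

text \<open>Ruan's bimodule inequality, with both scalar factors of norm at most 1.\<close>

lemma (in operator_space) mnorm_mult_hermitian_idempotent:
  assumes P: "hermitian_idempotent p P" and Q: "hermitian_idempotent q Q" and x: "x \<in> carrier_mat p q"
  shows "mnorm (bimod_mult (mat p p (\<lambda>(i, j). P i j)) x (mat q q (\<lambda>(i, j). Q i j))) \<le> mnorm x"
proof -
  note P' = cmat_norm_hermitian_idempotent[OF P] and Q' = cmat_norm_hermitian_idempotent[OF Q]
  have "mnorm (bimod_mult (mat p p (\<lambda>(i, j). P i j)) x (mat q q (\<lambda>(i, j). Q i j)))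
      \<le> cmat_norm (mat p p (\<lambda>(i, j). P i j)) * mnorm x * cmat_norm (mat q q (\<lambda>(i, j). Q i j))"
    using x by (intro mnorm_bimod) auto
  also have "\<dots> \<le> (1 * mnorm x) * 1"
    using P' Q' mnorm_nonneg[of x] by (intro mult_mono) auto
  finally show ?thesis by simp
qed

lemma (in operator_space) mnorm_mult_hermitian_idempotent_right:
  assumes P: "hermitian_idempotent k P" and x: "x \<in> carrier_mat n k"
  shows "mnorm (mat n k (\<lambda>(i, j). \<Sum>l<k. P l j *\<^sub>C x $$ (i, l))) \<le> mnorm x"
proof -
  let ?I = "mat n n (\<lambda>(i, j). if i = j then 1 else 0 :: complex)"
  have "bimod_mult ?I x (mat k k (\<lambda>(i, j). P i j)) = mat n k (\<lambda>(i, j). \<Sum>l<k. P l j *\<^sub>C x $$ (i, l))"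
  proof (rule eq_matI)
    fix i j assume "i < dim_row (mat n k (\<lambda>(i, j). \<Sum>l<k. P l j *\<^sub>C x $$ (i, l)))"
      "j < dim_col (mat n k (\<lambda>(i, j). \<Sum>l<k. P l j *\<^sub>C x $$ (i, l)))"
    then have ij: "i < n" "j < k" by simp_all
    have "(\<Sum>p<n. \<Sum>l<k. (?I $$ (i, p) * P l j) *\<^sub>C x $$ (p, l))
        = (\<Sum>p<n. if i = p then \<Sum>l<k. P l j *\<^sub>C x $$ (p, l) else 0)"
      using ij by (intro sum.cong) auto
    then show "bimod_mult ?I x (mat k k (\<lambda>(i, j). P i j)) $$ (i, j)
        = mat n k (\<lambda>(i, j). \<Sum>l<k. P l j *\<^sub>C x $$ (i, l)) $$ (i, j)"
      using ij x by (simp add: bimod_mult_def)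
  qed (use x in \<open>simp_all add: bimod_mult_def\<close>)
  then show ?thesis
    using mnorm_mult_hermitian_idempotent[OF hermitian_idempotent_one P x] by simp
qed

lemma (in operator_space) mnorm_mult_hermitian_idempotent_left:
  assumes P: "hermitian_idempotent k P" and x: "x \<in> carrier_mat k m"
  shows "mnorm (mat k m (\<lambda>(i, j). \<Sum>l<k. P i l *\<^sub>C x $$ (l, j))) \<le> mnorm x"
proof -
  let ?I = "mat m m (\<lambda>(i, j). if i = j then 1 else 0 :: complex)"
  have "bimod_mult (mat k k (\<lambda>(i, j). P i j)) x ?I = mat k m (\<lambda>(i, j). \<Sum>l<k. P i l *\<^sub>C x $$ (l, j))"
  proof (rule eq_matI)
    fix i j assume "i < dim_row (mat k m (\<lambda>(i, j). \<Sum>l<k. P i l *\<^sub>C x $$ (l, j)))"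
      "j < dim_col (mat k m (\<lambda>(i, j). \<Sum>l<k. P i l *\<^sub>C x $$ (l, j)))"
    then have ij: "i < k" "j < m" by simp_all
    have "(\<Sum>l<m. (P i p * ?I $$ (l, j)) *\<^sub>C x $$ (p, l))
        = (\<Sum>l<m. if l = j then P i p *\<^sub>C x $$ (p, l) else 0)" for p
      using ij by (intro sum.cong) auto
    then show "bimod_mult (mat k k (\<lambda>(i, j). P i j)) x ?I $$ (i, j)
        = mat k m (\<lambda>(i, j). \<Sum>l<k. P i l *\<^sub>C x $$ (l, j)) $$ (i, j)"
      using ij x by (simp add: bimod_mult_def)
  qed (use x in \<open>simp_all add: bimod_mult_def\<close>)
  then show ?thesis
    using mnorm_mult_hermitian_idempotent[OF P hermitian_idempotent_one x] by simp
qed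


section \<open>Haagerup factorizations\<close>

lemma map_mat_mat_tensor:
  assumes "clinear f" "clinear g" "dim_col x = dim_row y"
  shows "map_mat (tensor_map f g) (x \<odot>\<^sub>t y) = map_mat f x \<odot>\<^sub>t map_mat g y"
  using assms
  by (intro eq_matI)
    (auto simp: mat_tensor_def clinear_sum[OF clinear_tensor_map] tensor_map_tensor_elem)

text \<open>The inner dimension gets one index for every elementary tensor occurring in any entry of
  \<open>z\<close>. This makes the set in the definition of the Haagerup norm nonempty.\<close>

lemma ex_mat_tensor:
  fixes z :: "('a::complex_vector, 'b::complex_vector) tensor mat"
  assumes "z \<in> carrier_mat n m"
  obtains k x y where "x \<in> carrier_mat n k" "y \<in> carrier_mat k m" "z = x \<odot>\<^sub>t y"
proof -
  have "\<forall>i j. \<exists>(r::nat) a b. z $$ (i, j) = (\<Sum>q<r. a q \<otimes>\<^sub>t b q)"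
    using tensor_finite_sum by blast
  then obtain r :: "nat \<Rightarrow> nat \<Rightarrow> nat" and a b
    where z: "\<And>i j. z $$ (i, j) = (\<Sum>q<r i j. a i j q \<otimes>\<^sub>t b i j q)"
    by metis
  define S where "S = (SIGMA i:{..<n}. SIGMA j:{..<m}. {..<r i j})"
  have "finite S" by (auto simp: S_def)
  then obtain h where h: "bij_betw h {..<card S} S"
    using ex_bij_betw_nat_finite[of S] by (auto simp: atLeast0LessThan)
  \<comment> \<open>A triple \<open>(i', j', q)\<close> contributes only to row \<open>i'\<close> of
    \<open>x\<close> and column \<open>j'\<close> of \<open>y\<close>, so entry
    \<open>(i, j)\<close> of the product collects exactly the summands of
    \<open>z $$ (i, j)\<close>.\<close>
  define F where "F i = (\<lambda>(i', j', q). if i' = i then a i' j' q else 0)" for i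
  define G where "G j = (\<lambda>(i', j', q). if j' = j then b i' j' q else 0)" for j
  define x where "x = mat n (card S) (\<lambda>(i, l). F i (h l))"
  define y where "y = mat (card S) m (\<lambda>(l, j). G j (h l))"
  have "z = x \<odot>\<^sub>t y"
  proof (rule eq_matI)
    fix i j assume "i < dim_row (x \<odot>\<^sub>t y)" "j < dim_col (x \<odot>\<^sub>t y)"
    then have ij: "i < n" "j < m" by (simp_all add: mat_tensor_def x_def y_def)
    have zero: "0 \<otimes>\<^sub>t v = 0" "u \<otimes>\<^sub>t 0 = 0" for u :: 'a and v :: 'b
      by (rule clinear_zero[OF clinear_tensor_left], rule clinear_zero[OF clinear_tensor_right])
    have "(x \<odot>\<^sub>t y) $$ (i, j) = (\<Sum>l<card S. F i (h l) \<otimes>\<^sub>t G j (h l))"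
      using ij by (simp add: mat_tensor_def x_def y_def)
    also have "\<dots> = (\<Sum>s\<in>S. F i s \<otimes>\<^sub>t G j s)"
      by (rule sum.reindex_bij_betw[OF h])
    also have "\<dots> = (\<Sum>i'<n. \<Sum>j'<m. \<Sum>q<r i' j'. F i (i', j', q) \<otimes>\<^sub>t G j (i', j', q))"
      unfolding S_def by (simp add: sum.Sigma split_def)
    also have "\<dots> = (\<Sum>i'<n. if i' = i then \<Sum>j'<m. if j' = j then z $$ (i, j) else 0 else 0)"
    proof -
      have "(\<Sum>q<r i' j'. F i (i', j', q) \<otimes>\<^sub>t G j (i', j', q))
          = (if i' = i then if j' = j then z $$ (i, j) else 0 else 0)" for i' j'
        by (simp add: F_def G_def zero z)
      then show ?thesis by (intro sum.cong refl) simp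
    qed
    also have "\<dots> = z $$ (i, j)"
      using ij by simp
    finally show "z $$ (i, j) = (x \<odot>\<^sub>t y) $$ (i, j)" by simp
  qed (use assms in \<open>simp_all add: mat_tensor_def x_def y_def\<close>)
  then show ?thesis
    by (intro that[of x "card S" y]) (simp_all add: x_def y_def)
qed

section \<open>Bounds for the Haagerup norm\<close>

text \<open>A real \<open>Inf\<close> is below the members of its set once the set is bounded below;
  here 0 is a bound, since matrix norms are nonnegative.\<close>

lemma haagerup_norm_le:
  assumes "operator_space NX" "operator_space NY"
    and "x \<in> carrier_mat n k" "y \<in> carrier_mat k m"
  shows "haagerup_norm NX NY (x \<odot>\<^sub>t y) \<le> NX x * NY y"
  unfolding haagerup_norm_def
proof (rule cInf_lower)
  have dim: "dim_row (x \<odot>\<^sub>t y) = n" "dim_col (x \<odot>\<^sub>t y) = m"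
    using assms(3,4) by (simp_all add: mat_tensor_def)
  show "NX x * NY y \<in> {NX x' * NY y' |x' y' k. x' \<in> carrier_mat (dim_row (x \<odot>\<^sub>t y)) k \<and>
      y' \<in> carrier_mat k (dim_col (x \<odot>\<^sub>t y)) \<and> x \<odot>\<^sub>t y = x' \<odot>\<^sub>t y'}"
    using assms(3,4) unfolding dim by blast
qed (auto intro!: bdd_belowI[of _ 0] mult_nonneg_nonneg operator_space.mnorm_nonneg[OF assms(1)]
    operator_space.mnorm_nonneg[OF assms(2)])

lemma le_haagerup_norm:
  assumes z: "z \<in> carrier_mat n m"
    and le: "\<And>k x y. x \<in> carrier_mat n k \<Longrightarrow> y \<in> carrier_mat k m \<Longrightarrow> z = x \<odot>\<^sub>t y \<Longrightarrow> B \<le> NX x * NY y"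
  shows "B \<le> haagerup_norm NX NY z"
  unfolding haagerup_norm_def
proof (rule cInf_greatest)
  obtain k x y where "x \<in> carrier_mat n k" "y \<in> carrier_mat k m" "z = x \<odot>\<^sub>t y"
    using ex_mat_tensor[OF z] by blast
  then show "{NX x * NY y |x y k. x \<in> carrier_mat (dim_row z) k \<and> y \<in> carrier_mat k (dim_col z) \<and>
      z = x \<odot>\<^sub>t y} \<noteq> {}"
    using z by auto
qed (use z le in auto)

section \<open>Moving factors into the ranges\<close>

text \<open>The projection is built from \<open>y\<close> and only \<open>x\<close> is changed, so
  the right factor can be treated afterwards.\<close>

lemma haagerup_factor_left:
  fixes f1 :: "'a::complex_vector \<Rightarrow> 'c::complex_vector"
    and f2 :: "'b::complex_vector \<Rightarrow> 'd::complex_vector"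
  assumes N: "operator_space N" and f: "clinear f1" "clinear f2"
    and x: "x \<in> carrier_mat n k" and y: "y \<in> carrier_mat k m" and z: "z \<in> carrier_mat n m"
    and eq: "map_mat (tensor_map f1 f2) z = x \<odot>\<^sub>t y"
  obtains x' where "x' \<in> carrier_mat n k" "N (map_mat f1 x') \<le> N x"
    and "map_mat (tensor_map f1 f2) z = map_mat f1 x' \<odot>\<^sub>t y"
proof -
  obtain P :: "nat \<Rightarrow> nat \<Rightarrow> complex" and g :: "nat \<Rightarrow> nat \<Rightarrow> 'd \<Rightarrow> complex"
    where P: "hermitian_idempotent k P"
      and Py: "\<And>l j. l < k \<Longrightarrow> j < m \<Longrightarrow> (\<Sum>p<k. P l p *\<^sub>C y $$ (p, j)) = y $$ (l, j)"
      and g: "\<And>p j. clinear (g p j)" and Pg: "\<And>l p. P l p = (\<Sum>j<m. g p j (y $$ (l, j)))"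
    using hermitian_idempotent_of_functionals[of k m "\<lambda>l j. y $$ (l, j)"] by blast
  define X where "X = mat n k (\<lambda>(i, j). \<Sum>l<k. P l j *\<^sub>C x $$ (i, l))"
  define x' where "x' = map_mat (inv_into UNIV f1) X"
  \<comment> \<open>\<open>X\<close> is \<open>x P\<close>. Expanding \<open>P l p\<close> by
    \<open>Pg\<close>, the part of this entry belonging to \<open>j\<close> is the slice of entry
    \<open>(i, j)\<close> of the image of \<open>z\<close> by \<open>g p j\<close>.\<close>
  have "X $$ (i, p) \<in> range f1" if i: "i < n" and p: "p < k" for i p
  proof -
    have "(\<Sum>l<k. g p j (y $$ (l, j)) *\<^sub>C x $$ (i, l)) \<in> range f1" if j: "j < m" for j
    proof (rule slice_right_range[OF g f])
      show "tensor_map f1 f2 (z $$ (i, j)) = (\<Sum>l<k. x $$ (i, l) \<otimes>\<^sub>t y $$ (l, j))"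
        using arg_cong[OF eq, of "\<lambda>A. A $$ (i, j)"] i j x y z by (simp add: mat_tensor_def)
    qed
    from sum_functionals_in_range[OF f(1) this] show ?thesis
      using i p by (simp add: X_def Pg)
  qed
  then have x'X: "map_mat f1 x' = X"
    by (intro eq_matI) (auto simp: x'_def X_def f_inv_into_f)
  \<comment> \<open>\<open>P\<close> moves across the tensor sign: \<open>x P\<close> against
    \<open>y\<close> equals \<open>x\<close> against \<open>P y\<close>, and
    \<open>P y = y\<close>.\<close>
  have "x \<odot>\<^sub>t y = X \<odot>\<^sub>t y"
  proof (rule eq_matI)
    fix i j assume "i < dim_row (X \<odot>\<^sub>t y)" "j < dim_col (X \<odot>\<^sub>t y)"
    then have ij: "i < n" "j < m" using y by (simp_all add: mat_tensor_def X_def)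
    have "(X \<odot>\<^sub>t y) $$ (i, j) = (\<Sum>p<k. \<Sum>l<k. P l p *\<^sub>C (x $$ (i, l) \<otimes>\<^sub>t y $$ (p, j)))"
      using ij y
      by (simp add: mat_tensor_def X_def clinear_sum[OF clinear_tensor_left] tensor_elem_scaleC_left)
    also have "\<dots> = (\<Sum>l<k. x $$ (i, l) \<otimes>\<^sub>t (\<Sum>p<k. P l p *\<^sub>C y $$ (p, j)))"
      by (subst sum.swap) (simp add: clinear_sum[OF clinear_tensor_right] tensor_elem_scaleC_right)
    also have "\<dots> = (x \<odot>\<^sub>t y) $$ (i, j)"
      using ij x y by (simp add: mat_tensor_def Py)
    finally show "(x \<odot>\<^sub>t y) $$ (i, j) = (X \<odot>\<^sub>t y) $$ (i, j)" by simp
  qed (use x in \<open>simp_all add: mat_tensor_def X_def\<close>)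
  moreover have "N X \<le> N x"
    unfolding X_def by (rule operator_space.mnorm_mult_hermitian_idempotent_right[OF N P x])
  ultimately show ?thesis
    by (intro that[of x']) (simp_all add: x'X eq, simp add: x'_def X_def)
qed

text \<open>Mirror image with a transposition: \<open>P\<close> fixes the rows of \<open>x\<close>
  as vectors, that is, \<open>x\<close> times the transpose of \<open>P\<close> is \<open>x\<close>.
  Hence the transpose of \<open>P\<close> is what moves over to \<open>y\<close>, giving
  \<open>Y\<close>.\<close>

lemma haagerup_factor_right:
  fixes f1 :: "'a::complex_vector \<Rightarrow> 'c::complex_vector"
    and f2 :: "'b::complex_vector \<Rightarrow> 'd::complex_vector"
  assumes N: "operator_space N" and f: "clinear f1" "clinear f2"
    and x: "x \<in> carrier_mat n k" and y: "y \<in> carrier_mat k m" and z: "z \<in> carrier_mat n m"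
    and eq: "map_mat (tensor_map f1 f2) z = x \<odot>\<^sub>t y"
  obtains y' where "y' \<in> carrier_mat k m" "N (map_mat f2 y') \<le> N y"
    and "map_mat (tensor_map f1 f2) z = x \<odot>\<^sub>t map_mat f2 y'"
proof -
  obtain P :: "nat \<Rightarrow> nat \<Rightarrow> complex" and g :: "nat \<Rightarrow> nat \<Rightarrow> 'c \<Rightarrow> complex"
    where P: "hermitian_idempotent k P"
      and Px: "\<And>l i. l < k \<Longrightarrow> i < n \<Longrightarrow> (\<Sum>p<k. P l p *\<^sub>C x $$ (i, p)) = x $$ (i, l)"
      and g: "\<And>p i. clinear (g p i)" and Pg: "\<And>l p. P l p = (\<Sum>i<n. g p i (x $$ (i, l)))"
    using hermitian_idempotent_of_functionals[of k n "\<lambda>l i. x $$ (i, l)"] by blast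
  define Y where "Y = mat k m (\<lambda>(i, j). \<Sum>l<k. P l i *\<^sub>C y $$ (l, j))"
  define y' where "y' = map_mat (inv_into UNIV f2) Y"
  have "Y $$ (p, j) \<in> range f2" if p: "p < k" and j: "j < m" for p j
  proof -
    have "(\<Sum>l<k. g p i (x $$ (i, l)) *\<^sub>C y $$ (l, j)) \<in> range f2" if i: "i < n" for i
    proof (rule slice_left_range[OF g f])
      show "tensor_map f1 f2 (z $$ (i, j)) = (\<Sum>l<k. x $$ (i, l) \<otimes>\<^sub>t y $$ (l, j))"
        using arg_cong[OF eq, of "\<lambda>A. A $$ (i, j)"] i j x y z by (simp add: mat_tensor_def)
    qed
    from sum_functionals_in_range[OF f(2) this] show ?thesis
      using p j by (simp add: Y_def Pg)
  qed
  then have y'Y: "map_mat f2 y' = Y"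
    by (intro eq_matI) (auto simp: y'_def Y_def f_inv_into_f)
  have "x \<odot>\<^sub>t y = x \<odot>\<^sub>t Y"
  proof (rule eq_matI)
    fix i j assume "i < dim_row (x \<odot>\<^sub>t Y)" "j < dim_col (x \<odot>\<^sub>t Y)"
    then have ij: "i < n" "j < m" using x by (simp_all add: mat_tensor_def Y_def)
    have "(x \<odot>\<^sub>t Y) $$ (i, j) = (\<Sum>p<k. \<Sum>l<k. P l p *\<^sub>C (x $$ (i, p) \<otimes>\<^sub>t y $$ (l, j)))"
      using ij x
      by (simp add: mat_tensor_def Y_def clinear_sum[OF clinear_tensor_right] tensor_elem_scaleC_right)
    also have "\<dots> = (\<Sum>l<k. (\<Sum>p<k. P l p *\<^sub>C x $$ (i, p)) \<otimes>\<^sub>t y $$ (l, j))"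
      by (subst sum.swap) (simp add: clinear_sum[OF clinear_tensor_left] tensor_elem_scaleC_left)
    also have "\<dots> = (x \<odot>\<^sub>t y) $$ (i, j)"
      using ij x y by (simp add: mat_tensor_def Px)
    finally show "(x \<odot>\<^sub>t y) $$ (i, j) = (x \<odot>\<^sub>t Y) $$ (i, j)" by simp
  qed (use y in \<open>simp_all add: mat_tensor_def Y_def\<close>)
  moreover have "N Y \<le> N y"
    unfolding Y_def
    by (rule operator_space.mnorm_mult_hermitian_idempotent_left[OF N hermitian_idempotent_transpose[OF P] y])
  ultimately show ?thesis
    by (intro that[of y']) (simp_all add: y'Y eq, simp add: y'_def Y_def)
qed

section \<open>Tensor maps of complete contractions and complete isometries\<close>

theorem completely_contractive_tensor_map:
  assumes V: "operator_space NV1" "operator_space NV2" and W: "operator_space NW1" "operator_space NW2"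
    and f: "completely_contractive NV1 NW1 f1" and g: "completely_contractive NV2 NW2 f2"
  shows "completely_contractive (haagerup_norm NV1 NV2) (haagerup_norm NW1 NW2) (tensor_map f1 f2)"
proof -
  have lin: "clinear f1" "clinear f2"
    using f g by (simp_all add: completely_contractive_def)
  have "haagerup_norm NW1 NW2 (map_mat (tensor_map f1 f2) z) \<le> haagerup_norm NV1 NV2 z"
    if z: "z \<in> carrier_mat n n" for n z
  proof (rule le_haagerup_norm[OF z])
    fix k x y assume x: "x \<in> carrier_mat n k" and y: "y \<in> carrier_mat k n" and "z = x \<odot>\<^sub>t y"
    then have "map_mat (tensor_map f1 f2) z = map_mat f1 x \<odot>\<^sub>t map_mat f2 y"
      by (simp add: map_mat_mat_tensor[OF lin])
    then have "haagerup_norm NW1 NW2 (map_mat (tensor_map f1 f2) z)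
        \<le> NW1 (map_mat f1 x) * NW2 (map_mat f2 y)"
      using haagerup_norm_le[OF W map_carrier_mat[THEN iffD2, OF x] map_carrier_mat[THEN iffD2, OF y]]
      by simp
    also have "\<dots> \<le> NV1 x * NV2 y"
      using completely_contractiveD[OF V(1) W(1) f] completely_contractiveD[OF V(2) W(2) g]
      by (intro mult_mono) (auto intro: operator_space.mnorm_nonneg V W)
    finally show "haagerup_norm NW1 NW2 (map_mat (tensor_map f1 f2) z) \<le> NV1 x * NV2 y" .
  qed
  then show ?thesis
    by (simp add: completely_contractive_def clinear_tensor_map lin)
qed

theorem completely_isometric_tensor_map:
  assumes V: "operator_space NV1" "operator_space NV2" and W: "operator_space NW1" "operator_space NW2"
    and f: "completely_isometric NV1 NW1 f1" and g: "completely_isometric NV2 NW2 f2"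
  shows "completely_isometric (haagerup_norm NV1 NV2) (haagerup_norm NW1 NW2) (tensor_map f1 f2)"
proof -
  have lin: "clinear f1" "clinear f2"
    using f g by (simp_all add: completely_isometric_def)
  have inj: "inj (tensor_map f1 f2)"
    by (intro tensor_map_inj lin completely_isometric_inj[OF V(1) W(1) f]
        completely_isometric_inj[OF V(2) W(2) g])
  have "haagerup_norm NV1 NV2 z \<le> haagerup_norm NW1 NW2 (map_mat (tensor_map f1 f2) z)"
    if z: "z \<in> carrier_mat n n" for n z
  proof (rule le_haagerup_norm)
    show "map_mat (tensor_map f1 f2) z \<in> carrier_mat n n"
      using z by simp
    fix k x y assume x: "x \<in> carrier_mat n k" and y: "y \<in> carrier_mat k n"
      and eq: "map_mat (tensor_map f1 f2) z = x \<odot>\<^sub>t y"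
    obtain x' where x': "x' \<in> carrier_mat n k" "NW1 (map_mat f1 x') \<le> NW1 x"
      and eq': "map_mat (tensor_map f1 f2) z = map_mat f1 x' \<odot>\<^sub>t y"
      using haagerup_factor_left[OF W(1) lin x y z eq] by blast
    \<comment> \<open>The second correction starts from the corrected left factor and leaves it
      unchanged, so both factors end up as images.\<close>
    have "map_mat f1 x' \<in> carrier_mat n k"
      using x' by simp
    from haagerup_factor_right[OF W(2) lin this y z eq'] obtain y'
      where y': "y' \<in> carrier_mat k n" "NW2 (map_mat f2 y') \<le> NW2 y"
        and eq'': "map_mat (tensor_map f1 f2) z = map_mat f1 x' \<odot>\<^sub>t map_mat f2 y'"
      by blast
    have "map_mat (tensor_map f1 f2) z = map_mat (tensor_map f1 f2) (x' \<odot>\<^sub>t y')"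
      using x' y' by (simp add: eq'' map_mat_mat_tensor[OF lin])
    then have "z = x' \<odot>\<^sub>t y'"
      by (rule injD[OF inj_map_mat[OF inj]])
    then have "haagerup_norm NV1 NV2 z \<le> NV1 x' * NV2 y'"
      using haagerup_norm_le[OF V x'(1) y'(1)] by simp
    \<comment> \<open>The factors are rectangular; the isometry property reaches them through
      padding.\<close>
    also have "\<dots> = NW1 (map_mat f1 x') * NW2 (map_mat f2 y')"
      by (simp add: completely_isometricD[OF V(1) W(1) f] completely_isometricD[OF V(2) W(2) g])
    also have "\<dots> \<le> NW1 x * NW2 y"
      using x' y' by (intro mult_mono) (auto intro: operator_space.mnorm_nonneg W)
    finally show "haagerup_norm NV1 NV2 z \<le> NW1 x * NW2 y" .
  qed
  \<comment> \<open>The contractive theorem supplies the reverse inequality.\<close>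
  moreover have "completely_contractive NV1 NW1 f1" "completely_contractive NV2 NW2 f2"
    using f g by (simp_all add: completely_isometric_def completely_contractive_def)
  note completely_contractive_tensor_map[OF V W this]
  ultimately show ?thesis
    unfolding completely_isometric_def completely_contractive_def by (meson order_antisym)
qed

theorem proposition3p3:
  fixes NV1 :: "'v1::complex_vector mat \<Rightarrow> real" and NV2 :: "'v2::complex_vector mat \<Rightarrow> real"
    and NW1 :: "'w1::complex_vector mat \<Rightarrow> real" and NW2 :: "'w2::complex_vector mat \<Rightarrow> real"
    and e1 :: 'v1 and e2 :: 'v2 and f1 :: 'w1 and f2 :: 'w2
    and \<phi>1 :: "'v1 \<Rightarrow> 'w1" and \<phi>2 :: "'v2 \<Rightarrow> 'w2"
  assumes "unital_operator_space TYPE('hv1::chilbert_space) NV1 e1"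
    and "unital_operator_space TYPE('hv2::chilbert_space) NV2 e2"
    and "unital_operator_space TYPE('hw1::chilbert_space) NW1 f1"
    and "unital_operator_space TYPE('hw2::chilbert_space) NW2 f2"
    and "completely_contractive NV1 NW1 \<phi>1" and "\<phi>1 e1 = f1"
    and "completely_contractive NV2 NW2 \<phi>2" and "\<phi>2 e2 = f2"
  shows "(completely_contractive (haagerup_norm NV1 NV2) (haagerup_norm NW1 NW2) (tensor_map \<phi>1 \<phi>2)
        \<and> tensor_map \<phi>1 \<phi>2 (e1 \<otimes>\<^sub>t e2) = f1 \<otimes>\<^sub>t f2)
    \<and> (completely_isometric NV1 NW1 \<phi>1 \<and> completely_isometric NV2 NW2 \<phi>2 \<longrightarrow>
        completely_isometric (haagerup_norm NV1 NV2) (haagerup_norm NW1 NW2) (tensor_map \<phi>1 \<phi>2)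
        \<and> tensor_map \<phi>1 \<phi>2 (e1 \<otimes>\<^sub>t e2) = f1 \<otimes>\<^sub>t f2)"
proof -
  have os: "operator_space NV1" "operator_space NV2" "operator_space NW1" "operator_space NW2"
    using assms by (simp_all add: unital_operator_space_def)
  have lin: "clinear \<phi>1" "clinear \<phi>2"
    using assms by (simp_all add: completely_contractive_def)
  \<comment> \<open>The units of the Haagerup products are \<open>e1 \<otimes>\<^sub>t e2\<close>
    and \<open>f1 \<otimes>\<^sub>t f2\<close>, so unitality is a value on one elementary
    tensor.\<close>
  have unit: "tensor_map \<phi>1 \<phi>2 (e1 \<otimes>\<^sub>t e2) = f1 \<otimes>\<^sub>t f2"
    by (simp add: tensor_map_tensor_elem[OF lin] assms)
  show ?thesis
    using completely_contractive_tensor_map[OF os assms(5,7)]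
      completely_isometric_tensor_map[OF os] unit by blast
qed

end
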